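(* For every integer $d\ge 2$ there exist probability measures $\mu$ and $\nu$ over $\mathbb{R}^d$, each having finite support and taking only rational values, such that $\mu_v\preceq\nu_v$ for all $v\in\mathbb{R}^d$ but $\mu\not\preceq\nu$. That is, for $d\ge2$ the convex order between all one-dimensional projections (distributions of linear functionals) does not imply the convex order between the probability distributions over $\mathbb{R}^d$.
   Context: For probability measures $\mu,\nu$ over $\mathbb{R}^n$ ($n\ge1$) with $\int_{\mathbb{R}^n}\|x\|\,\mu(dx)<\infty$ and $\int_{\mathbb{R}^n}\|x\|\,\nu(dx)<\infty$ (where $\|\cdot\|$ is the Euclidean norm), one writes $\mu\preceq\nu$ ($\mu$ is dominated by $\nu$ in the convex order) if $\int_{\mathbb{R}^n} f\,d\mu\le\int_{\mathbb{R}^n} f\,d\nu$ for all convex functions $f\colon\mathbb{R}^n\to\mathbb{R}$. The integrals always exist but may take the value $\infty$. For a probability measure $\lambda$ over $\mathbb{R}^d$ and $v\in\mathbb{R}^d$, $\lambda_v$ denotes the $v$-projection of $\lambda$, i.e. the pushforward of $\lambda$ under the linear map $p_v\colon\mathbb{R}^d\to\mathbb{R}$, $p_v(x):=v\cdot x$, where $\cdot$ is the dot product; $\lambda_v$ is a probability measure over $\mathbb{R}$, and $\mu_v\preceq\nu_v$ is the convex order for $n=1$. *)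

theory Defs
  imports "HOL-Probability.Probability"
begin

(* The integral of f as positive part minus negative part. For a convex f and a probability
   measure with finite first moment the subtrahend is finite, because f has an affine minorant;
   so the value is the usual one, possibly \<infinity>, and \<infinity> - \<infinity> does not arise. *)
definition ereal_integral :: "'a measure \<Rightarrow> ('a \<Rightarrow> real) \<Rightarrow> ereal" where
  "ereal_integral M f =
     enn2ereal (\<integral>\<^sup>+x. ennreal (f x) \<partial>M) - enn2ereal (\<integral>\<^sup>+x. ennreal (- f x) \<partial>M)"

(* Meant for Borel probability measures with finite first moment. These conditions are
   deliberately not conjuncts: a negated convex_le should only ever say that the
   inequality fails for some convex f. *)
definition convex_le :: "'a::euclidean_space measure \<Rightarrow> 'a measure \<Rightarrow> bool" where
  "convex_le \<mu> \<nu> \<longleftrightarrow>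
     (\<forall>f. convex_on UNIV f \<longrightarrow> ereal_integral \<mu> f \<le> ereal_integral \<nu> f)"

definition borel_prob :: "'a::topological_space measure \<Rightarrow> bool" where
  "borel_prob \<mu> \<longleftrightarrow> prob_space \<mu> \<and> sets \<mu> = sets borel"

definition msupport :: "'a::topological_space measure \<Rightarrow> 'a set" where
  "msupport \<mu> = {x. \<forall>U. open U \<and> x \<in> U \<longrightarrow> emeasure \<mu> U > 0}"

definition rational_valued :: "'a measure \<Rightarrow> bool" where
  "rational_valued \<mu> \<longleftrightarrow> (\<forall>A\<in>sets \<mu>. measure \<mu> A \<in> \<rat>)"

definition projection :: "'a::euclidean_space \<Rightarrow> 'a measure \<Rightarrow> real measure" where
  "projection v \<mu> = distr \<mu> borel (\<lambda>x. v \<bullet> x)"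

end

theory Submission
  imports Defs
begin

text \<open>
  The counterexample comes from Popoviciu's inequality: for a convex function g of one real
  variable, the values at three points together with three times the value at their mean dominate
  twice the sum of the values at the three pairwise midpoints (lemma popoviciu). This is an
  inequality between integrals of g against two empirical measures, and it persists when the three
  points are the images of the vertices of a triangle under a linear functional. So if nu gives
  weight 1/6 to each vertex of a triangle and 1/2 to its barycentre, and mu gives weight 1/3 to
  each midpoint of an edge, every one-dimensional projection of mu is dominated by that of nu.

  In the plane Popoviciu's inequality fails: a convex function that is zero on the boundary of the
  triangle and negative at the barycentre, such as the maximum of the three affine functions that
  vanish on one edge each and are negative inside, has integral zero under mu and a negative
  integral under nu. What is special about the line is that one of the three points lies
  on one side of the mean and the other two on the opposite side, which places two of the midpoints
  on the segment from the mean to that single point. In dimension larger than two, the triangle is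
  put into a coordinate plane.
\<close>

section \<open>Popoviciu's inequality\<close>

text \<open>
  The sum condition says that the weights of \<open>w\<close> in \<open>p\<close> and \<open>q\<close>
  add up to one half, whatever the individual weights are.
\<close>
lemma convex_on_segment_pair:
  fixes g :: "'a::real_vector \<Rightarrow> real"
  assumes g: "convex_on UNIV g"
    and p: "p \<in> closed_segment m w" and q: "q \<in> closed_segment m w"
    and sum: "2 *\<^sub>R (p + q) = 3 *\<^sub>R m + w"
  shows "2 * (g p + g q) \<le> 3 * g m + g w"
proof -
  obtain s where s: "0 \<le> s" "s \<le> 1" "p = (1 - s) *\<^sub>R m + s *\<^sub>R w"
    using p by (auto simp: in_segment)
  obtain t where t: "0 \<le> t" "t \<le> 1" "q = (1 - t) *\<^sub>R m + t *\<^sub>R w"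
    using q by (auto simp: in_segment)
  show ?thesis
  proof (cases "m = w")
    case True
    with s(3) t(3) have "p = m" "q = m"
      by (simp_all flip: scaleR_add_left)
    with True show ?thesis by simp
  next
    case False
    have "(2 * (s + t) - 1) *\<^sub>R (w - m) = 2 *\<^sub>R (p + q) - (3 *\<^sub>R m + w)"
      unfolding s(3) t(3) using scaleR_add_left[of 1 3 m] scaleR_add_left[of 2 2 m]
      by (simp add: algebra_simps)
    with sum False have st: "t = 1 / 2 - s"
      by simp
    have "g p \<le> (1 - s) * g m + s * g w" "g q \<le> (1 - t) * g m + t * g w"
      unfolding s(3) t(3) using convex_onD[OF g] s t by auto
    then have "2 * (g p + g q) \<le> 2 * ((1 - s) * g m + s * g w + ((1 - t) * g m + t * g w))"
      by (intro mult_left_mono add_mono) auto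
    also have "\<dots> = 3 * g m + g w"
      unfolding st by (simp add: algebra_simps)
    finally show ?thesis .
  qed
qed

text \<open>
  The product condition puts \<open>a\<close> and \<open>b\<close> on the same side of the mean, so that the midpoints
  involving \<open>c\<close> lie between the mean and \<open>c\<close>; the midpoint of \<open>a\<close> and \<open>b\<close> is handled by
  convexity alone.
\<close>
lemma popoviciu_same_side:
  fixes g :: "real \<Rightarrow> real"
  assumes g: "convex_on UNIV g"
    and m: "m = (a + b + c) / 3" and side: "(a - m) * (b - m) \<ge> 0"
  shows "2 * (g ((a + b) / 2) + g ((b + c) / 2) + g ((c + a) / 2)) \<le> g a + g b + g c + 3 * g m"
proof -
  have "(b + c) / 2 \<in> closed_segment m c" "(c + a) / 2 \<in> closed_segment m c"
    using side m by (auto simp: closed_segment_eq_real_ivl zero_le_mult_iff)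
  moreover have "2 *\<^sub>R ((b + c) / 2 + (c + a) / 2) = 3 *\<^sub>R m + c"
    using m by (simp add: field_simps)
  ultimately have "2 * (g ((b + c) / 2) + g ((c + a) / 2)) \<le> 3 * g m + g c"
    by (rule convex_on_segment_pair[OF g])
  moreover have "2 * g ((a + b) / 2) \<le> g a + g b"
    using convex_onD[OF g, of "1 / 2" a b] by (simp add: add_divide_distrib)
  ultimately show ?thesis by (simp add: algebra_simps)
qed

lemma popoviciu:
  fixes g :: "real \<Rightarrow> real"
  assumes g: "convex_on UNIV g" and m: "m = (a + b + c) / 3"
  shows "2 * (g ((a + b) / 2) + g ((b + c) / 2) + g ((c + a) / 2)) \<le> g a + g b + g c + 3 * g m"
proof -
  have "m = (b + c + a) / 3" "m = (c + a + b) / 3"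
    using m by simp_all
  moreover have "(a - m) * (b - m) \<ge> 0 \<or> (b - m) * (c - m) \<ge> 0 \<or> (c - m) * (a - m) \<ge> 0"
    by (auto simp: zero_le_mult_iff)
  ultimately show ?thesis
    using popoviciu_same_side[OF g, of m a b c] popoviciu_same_side[OF g, of m b c a]
      popoviciu_same_side[OF g, of m c a b] m
    by argo
qed

section \<open>Empirical measures\<close>

definition empirical :: "'a::topological_space list \<Rightarrow> 'a measure" where
  "empirical xs = distr (measure_pmf (pmf_of_set {..<length xs})) borel (nth xs)"

lemma measure_empirical:
  assumes "xs \<noteq> []" "A \<in> sets borel"
  shows "measure (empirical xs) A = card {i. i < length xs \<and> xs ! i \<in> A} / length xs"
proof -
  have "{..<length xs} \<inter> nth xs -` A = {i. i < length xs \<and> xs ! i \<in> A}" by auto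
  with assms show ?thesis
    by (simp add: empirical_def measure_distr measure_pmf_of_set lessThan_empty_iff)
qed

lemma borel_prob_empirical: "borel_prob (empirical xs)"
  unfolding borel_prob_def empirical_def
  by (auto intro!: measure_pmf.prob_space_distr)

lemma rational_valued_empirical:
  assumes "xs \<noteq> []"
  shows "rational_valued (empirical xs)"
  using assms borel_prob_empirical[of xs]
  by (simp add: rational_valued_def borel_prob_def measure_empirical)

lemma finite_msupport_empirical:
  fixes xs :: "'a::t1_space list"
  assumes "xs \<noteq> []"
  shows "finite (msupport (empirical xs))"
proof (rule finite_subset)
  interpret prob_space "empirical xs"
    using borel_prob_empirical by (auto simp: borel_prob_def)
  show "msupport (empirical xs) \<subseteq> set xs"
  proof
    fix x assume x: "x \<in> msupport (empirical xs)"
    have "open (- set xs)"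
      by (simp add: open_Compl finite_imp_closed)
    moreover from this have "emeasure (empirical xs) (- set xs) = 0"
      using assms by (simp add: emeasure_eq_measure measure_empirical)
    ultimately show "x \<in> set xs"
      using x by (force simp: msupport_def)
  qed
qed simp

lemma projection_empirical:
  fixes xs :: "'a::euclidean_space list"
  assumes "xs \<noteq> []"
  shows "projection v (empirical xs) = empirical (map (\<lambda>x. v \<bullet> x) xs)"
proof -
  have "projection v (empirical xs) =
      distr (measure_pmf (pmf_of_set {..<length xs})) borel ((\<lambda>x. v \<bullet> x) \<circ> nth xs)"
    unfolding projection_def empirical_def by (rule distr_distr) auto
  also have "\<dots> = empirical (map (\<lambda>x. v \<bullet> x) xs)"
    unfolding empirical_def length_map
    by (rule distr_cong_AE) (use assms in \<open>auto simp: AE_measure_pmf_iff lessThan_empty_iff\<close>)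
  finally show ?thesis .
qed

lemma ereal_integral_empirical:
  fixes f :: "'a::euclidean_space \<Rightarrow> real"
  assumes xs: "xs \<noteq> []" and f: "convex_on UNIV f"
  shows "ereal_integral (empirical xs) f = ereal (sum_list (map f xs) / length xs)"
proof -
  have meas [measurable]: "f \<in> borel_measurable borel"
    using convex_on_continuous[OF open_UNIV f] by (rule borel_measurable_continuous_onI)
  have nonempty: "{..<length xs} \<noteq> {}"
    using xs by (auto simp: lessThan_empty_iff)
  then have "finite (set_pmf (pmf_of_set {..<length xs}))"
    by (simp add: set_pmf_of_set)
  then have int: "integrable (empirical xs) f"
    unfolding empirical_def by (simp add: integrable_distr_eq integrable_measure_pmf_finite)
  have "(\<integral>x. f x \<partial>empirical xs) = sum_list (map f xs) / length xs"
    unfolding empirical_def using nonempty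
    by (simp add: integral_distr integral_pmf_of_set sum_list_sum_nth atLeast0LessThan)
  moreover have "ereal_integral (empirical xs) f = ereal (\<integral>x. f x \<partial>empirical xs)"
  proof -
    obtain r s where rs: "(\<integral>\<^sup>+x. ennreal (f x) \<partial>empirical xs) = ennreal r" "0 \<le> r"
      "(\<integral>\<^sup>+x. ennreal (- f x) \<partial>empirical xs) = ennreal s" "0 \<le> s"
      using real_integrable_def[of "empirical xs" f] int
      by (metis ennreal_cases infinity_ennreal_def)
    show ?thesis
      unfolding real_lebesgue_integral_def[OF int] ereal_integral_def rs(1,3)
      using rs(2,4) by (simp add: enn2ereal_ennreal)
  qed
  ultimately show ?thesis by simp
qed

lemma convex_le_empirical_iff:
  assumes "xs \<noteq> []" "length ys = length xs"
  shows "convex_le (empirical xs) (empirical ys) \<longleftrightarrow>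
    (\<forall>f. convex_on UNIV f \<longrightarrow> sum_list (map f xs) \<le> sum_list (map f ys))"
proof -
  have "ys \<noteq> []" "length xs > 0" using assms by auto
  with assms show ?thesis
    by (simp add: convex_le_def ereal_integral_empirical divide_le_cancel cong: imp_cong)
qed

section \<open>The counterexample\<close>

lemma convex_on_max:
  fixes f g :: "'a::real_vector \<Rightarrow> real"
  assumes f: "convex_on S f" and g: "convex_on S g"
  shows "convex_on S (\<lambda>x. max (f x) (g x))"
proof (rule convex_onI)
  fix t x y assume t: "0 < (t::real)" "t < 1" and xy: "x \<in> S" "y \<in> S"
  have "f ((1 - t) *\<^sub>R x + t *\<^sub>R y) \<le> (1 - t) * f x + t * f y"
    "g ((1 - t) *\<^sub>R x + t *\<^sub>R y) \<le> (1 - t) * g x + t * g y"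
    using convex_onD[OF f] convex_onD[OF g] t xy by auto
  moreover have "(1 - t) * u + t * v \<le> (1 - t) * max u u' + t * max v v'"
    "(1 - t) * u' + t * v' \<le> (1 - t) * max u u' + t * max v v'" for u u' v v'
    using t by (auto intro!: add_mono mult_left_mono)
  ultimately show "max (f ((1 - t) *\<^sub>R x + t *\<^sub>R y)) (g ((1 - t) *\<^sub>R x + t *\<^sub>R y))
      \<le> (1 - t) * max (f x) (g x) + t * max (f y) (g y)"
    by (meson max.bounded_iff order_trans)
qed (rule convex_on_imp_convex[OF f])

text \<open>
  The barycentre and the midpoints are repeated so that both measures are
  empirical measures of lists of length six.
\<close>
theorem mainTheorem1:
  assumes "CARD('n::finite) \<ge> 2"
  shows "\<exists>\<mu> \<nu> :: (real ^ 'n) measure.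
    borel_prob \<mu> \<and> finite (msupport \<mu>) \<and> rational_valued \<mu> \<and>
    borel_prob \<nu> \<and> finite (msupport \<nu>) \<and> rational_valued \<nu> \<and>
    (\<forall>v. convex_le (projection v \<mu>) (projection v \<nu>)) \<and>
    \<not> convex_le \<mu> \<nu>"
proof -
  obtain i j :: 'n where ij: "i \<noteq> j"
    using assms by (metis (full_types) UNIV_I card_2_iff' card_le_Suc0_iff_eq finite_class.finite_UNIV
        not_less_eq_eq numeral_2_eq_2)
  \<comment> \<open>The side length 6 makes the midpoints and the barycentre integral.\<close>
  define A B C :: "real ^ 'n" where "A = 0" and "B = axis i 6" and "C = axis j 6"
  define P Q R G :: "real ^ 'n"
    where "P = axis i 3" and "Q = axis i 3 + axis j 3" and "R = axis j 3"
      and "G = axis i 2 + axis j 2"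
  define xs where "xs = [P, P, Q, Q, R, R]"
  define ys where "ys = [A, B, C, G, G, G]"
  have ne: "xs \<noteq> []" "ys \<noteq> []" and len: "length ys = length xs"
    by (simp_all add: xs_def ys_def)

  have "convex_le (projection v (empirical xs)) (projection v (empirical ys))" for v
  proof -
    have "sum_list (map g (map (\<lambda>x. v \<bullet> x) xs)) \<le> sum_list (map g (map (\<lambda>x. v \<bullet> x) ys))"
      if g: "convex_on UNIV g" for g :: "real \<Rightarrow> real"
    proof -
      define a b c where "a = v \<bullet> A" and "b = v \<bullet> B" and "c = v \<bullet> C"
      have proj: "v \<bullet> P = (a + b) / 2" "v \<bullet> Q = (b + c) / 2" "v \<bullet> R = (c + a) / 2"
        "v \<bullet> G = (a + b + c) / 3"
        by (simp_all add: a_def b_def c_def A_def B_def C_def P_def Q_def R_def G_def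
            inner_axis inner_add_right field_simps)
      have "sum_list (map g (map (\<lambda>x. v \<bullet> x) xs)) =
          2 * (g ((a + b) / 2) + g ((b + c) / 2) + g ((c + a) / 2))"
        by (simp add: xs_def proj)
      also have "\<dots> \<le> g a + g b + g c + 3 * g ((a + b + c) / 3)"
        by (rule popoviciu[OF g refl])
      also have "\<dots> = sum_list (map g (map (\<lambda>x. v \<bullet> x) ys))"
        by (simp add: ys_def proj flip: a_def b_def c_def)
      finally show ?thesis .
    qed
    then show ?thesis
      using ne len by (simp add: projection_empirical convex_le_empirical_iff)
  qed
  moreover have "\<not> convex_le (empirical xs) (empirical ys)"
  proof
    assume le: "convex_le (empirical xs) (empirical ys)"
    \<comment> \<open>Each of the three affine functions vanishes on one edge and is -2 at the barycentre.\<close>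
    define f :: "real ^ 'n \<Rightarrow> real"
      where "f x = max (max (- (x $ i)) (- (x $ j))) (x $ i + x $ j - 6)" for x
    have "convex_on UNIV f"
      unfolding f_def
      by (intro convex_on_max) (auto intro!: convex_onI simp: algebra_simps)
    with le have "sum_list (map f xs) \<le> sum_list (map f ys)"
      using ne len by (simp add: convex_le_empirical_iff)
    moreover have "sum_list (map f xs) = 0" "sum_list (map f ys) = - 6"
      using ij by (simp_all add: xs_def ys_def f_def A_def B_def C_def P_def Q_def R_def G_def
          axis_def)
    ultimately show False by simp
  qed
  ultimately show ?thesis
    using ne by (intro exI[of _ "empirical xs"] exI[of _ "empirical ys"])
      (simp add: borel_prob_empirical finite_msupport_empirical rational_valued_empirical)
qed

end
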